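(* Let $(G,+)$ be a commutative cancellative semigroup. Then there exists a partition $G=A_0\cup A_1$ of $G$ into two cells such that there is no uncountable $X\subseteq G$ and no $i\in 2$ with $\mathrm{FS}(X)\subseteq A_i$. In particular, $\mathrm{Hind}(G,\lambda)$ fails for every uncountable cardinal $\lambda$.
   Context: For $X\subseteq G$, $\mathrm{FS}(X)=\{\sum_{x\in F}x : F\subseteq X \text{ finite and nonempty}\}$ denotes the set of finite sums of (distinct) elements of $X$. For a commutative semigroup $G$ and a cardinal $\lambda$, $\mathrm{Hind}(G,\lambda)$ is the statement: for every partition $G=A_0\cup A_1$ into two cells there exist a set $X\subseteq G$ of cardinality $\lambda$ and an $i\in 2$ with $\mathrm{FS}(X)\subseteq A_i$. *)

theory Defs
  imports Main "HOL-Library.Countable_Set" "HOL-Library.Equipollence"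
begin

text \<open>fsum F s: s is the sum of the elements of the finite nonempty set F,
  in a semigroup (no neutral element available).\<close>
inductive fsum :: "'a::ab_semigroup_add set \<Rightarrow> 'a \<Rightarrow> bool" where
  single: "fsum {x} x"
| insert: "\<lbrakk>fsum F s; x \<notin> F\<rbrakk> \<Longrightarrow> fsum (insert x F) (x + s)"

definition FS :: "'a::ab_semigroup_add set \<Rightarrow> 'a set" where
  "FS X = {s. \<exists>F. F \<subseteq> X \<and> finite F \<and> F \<noteq> {} \<and> fsum F s}"

text \<open>Hind(G, lambda), with the cardinal lambda given as the cardinality of a set L
  (of an arbitrary type); G is the whole type 'a.\<close>
definition Hind :: "'a::ab_semigroup_add itself \<Rightarrow> 'b set \<Rightarrow> bool" where
  "Hind _ L = (\<forall>A0 A1 :: 'a set. A0 \<union> A1 = UNIV \<and> A0 \<inter> A1 = {} \<longrightarrow>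
      (\<exists>X. X \<approx> L \<and> (FS X \<subseteq> A0 \<or> FS X \<subseteq> A1)))"

end

theory Submission
  imports Defs "HOL-Library.Product_Plus" "HOL-Library.Function_Algebras"
begin

text \<open>The semigroup embeds into a direct sum of copies of the countable group
  \<open>\<rat> \<times> \<rat>/\<int>\<close>. Colour \<open>x\<close> by the parity of \<open>\<lfloor>log\<^sub>2 |supp x|\<rfloor>\<close>. An uncountable set
  contains, up to a fixed finite set of coordinates, infinitely many elements with pairwise disjoint
  supports of the same size \<open>m > 0\<close>, so the sum of \<open>n\<close> of them has support of size
  \<open>n m + O(1)\<close>; as \<open>n\<close> varies these sizes meet every dyadic interval far enough out,
  so both colours occur.\<close>

section \<open>Integer multiples\<close>

text \<open>Since \<open>nat\<close> truncates, at least one of the two iterates is zero, so one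
  formula covers both signs.\<close>

definition imul :: "int \<Rightarrow> 'g::ab_group_add \<Rightarrow> 'g" where
  "imul k g = (((+) g) ^^ nat k) 0 - (((+) g) ^^ nat (- k)) 0"

lemma imul_0 [simp]: "imul 0 g = 0"
  by (simp add: imul_def)

lemma imul_Suc: "imul (k + 1) g = imul k g + g"
proof (cases "k \<ge> 0")
  case True
  then have "nat (k + 1) = Suc (nat k)" "nat (- k) = 0" "nat (- (k + 1)) = 0" by auto
  then show ?thesis by (simp add: imul_def)
next
  case False
  then have "nat (- k) = Suc (nat (- (k + 1)))" "nat k = 0" "nat (k + 1) = 0" by auto
  then show ?thesis by (simp add: imul_def)
qed

lemma imul_pred: "imul (k - 1) g = imul k g - g"
  using imul_Suc[of "k - 1" g] by simp

lemma imul_1 [simp]: "imul 1 g = g"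
  using imul_Suc[of 0 g] by simp

text \<open>In a group the recursion also runs backwards, so it determines \<open>f\<close> on all
  integers. Most laws below follow by checking it for a suitable \<open>f\<close>.\<close>

lemma imul_unique:
  assumes "f 0 = 0" "\<And>k. f (k + 1) = f k + g"
  shows "f k = imul k g"
proof (induction k rule: int_induct[where k = 0])
  case (step2 i)
  have "f i = f (i - 1) + g" using assms(2)[of "i - 1"] by simp
  then show ?case using step2 by (simp add: imul_pred algebra_simps)
qed (use assms in \<open>auto simp: imul_Suc\<close>)

lemma imul_add: "imul (j + k) g = imul j g + imul k g"
proof -
  have "imul (j + (i + 1)) g - imul j g = (imul (j + i) g - imul j g) + g" for i
    using imul_Suc[of "j + i" g] by (simp add: add.assoc)
  then show ?thesis
    using imul_unique[of "\<lambda>k. imul (j + k) g - imul j g" g k] by (simp add: algebra_simps)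
qed

lemma imul_diff: "imul (j - k) g = imul j g - imul k g"
  using imul_add[of "j - k" k g] by simp

lemma imul_imul: "imul j (imul k g) = imul (j * k) g"
  using imul_unique[of "\<lambda>j. imul (j * k) g" "imul k g" j]
  by (simp add: imul_add distrib_right)

lemma imul_zero_right [simp]: "imul k 0 = 0"
  using imul_unique[of "\<lambda>k. 0" 0 k] by simp

lemma imul_Pair: "imul k (a, b) = (imul k a, imul k b)"
  using imul_unique[of "\<lambda>k. (imul k a, imul k b)" "(a, b)" k]
  by (simp add: imul_Suc zero_prod_def)

lemma imul_fun: "imul k f a = imul k (f a)"
  using imul_unique[of "\<lambda>k a. imul k (f a)" f k]
  by (simp add: imul_Suc fun_eq_iff)

text \<open>Division with remainder by the least positive element; the zero ideal gives
  \<open>d = 0\<close>.\<close>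

lemma int_ideal_principal:
  fixes I :: "int set"
  assumes zero: "0 \<in> I" and diff: "\<And>a b. a \<in> I \<Longrightarrow> b \<in> I \<Longrightarrow> a - b \<in> I"
    and mult: "\<And>a b. b \<in> I \<Longrightarrow> a * b \<in> I"
  obtains d where "\<And>k. k \<in> I \<longleftrightarrow> d dvd k"
proof (cases "I = {0}")
  case True
  then show ?thesis by (intro that[of 0]) auto
next
  case False
  then obtain a where a: "a \<in> I" "a \<noteq> 0" using zero by blast
  define n where "n = (LEAST n::nat. n > 0 \<and> int n \<in> I)"
  have "nat \<bar>a\<bar> > 0 \<and> int (nat \<bar>a\<bar>) \<in> I"
    using a mult[of a "sgn a"] by (simp flip: abs_sgn add: mult.commute[of "sgn a"])
  then have n: "n > 0 \<and> int n \<in> I" unfolding n_def by (rule LeastI)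
  show ?thesis
  proof (rule that[of "int n"], safe)
    fix k assume k: "k \<in> I"
    have "k mod int n = k - (k div int n) * int n" by (simp add: minus_div_mult_eq_mod)
    then have mem: "k mod int n \<in> I" using diff[OF k mult] n by simp
    show "int n dvd k"
    proof (rule ccontr)
      assume "\<not> int n dvd k"
      then have "k mod int n > 0" using n
        by (metis dvd_eq_mod_eq_0 of_nat_0_less_iff order_le_less pos_mod_sign)
      then have "n \<le> nat (k mod int n)" 
        using mem Least_le[of "\<lambda>n. n > 0 \<and> int n \<in> I" "nat (k mod int n)"] by (simp add: n_def)
      moreover have "k mod int n < int n" using n by simp
      ultimately show False using \<open>k mod int n > 0\<close> by linarith
    qed
  next
    fix k assume "int n dvd k"
    then show "k \<in> I" using n mult by (metis dvd_def mult.commute)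
  qed
qed

section \<open>A countable divisible group with elements of every order\<close>

text \<open>Divisibility of the quotient lets homomorphisms into it extend, its two factors supply
  elements of infinite and of every finite order, and its countability serves the counting of
  supports.\<close>

definition qqz_rel :: "rat \<times> rat \<Rightarrow> rat \<times> rat \<Rightarrow> bool" where
  "qqz_rel p q \<longleftrightarrow> fst p = fst q \<and> snd p - snd q \<in> \<int>"

quotient_type qqz = "rat \<times> rat" / qqz_rel
proof (rule equivpI)
  show "reflp qqz_rel" by (auto simp: reflp_def qqz_rel_def)
  show "symp qqz_rel"
    unfolding symp_def qqz_rel_def by (metis Ints_minus minus_diff_eq)
  show "transp qqz_rel"
    unfolding transp_def qqz_rel_def by (metis Ints_add diff_add_cancel add_diff_eq)
qed

instantiation qqz :: ab_group_add
begin

lift_definition zero_qqz :: qqz is "0" .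

lift_definition plus_qqz :: "qqz \<Rightarrow> qqz \<Rightarrow> qqz" is "(+)"
proof -
  fix p p' q q' :: "rat \<times> rat"
  assume *: "qqz_rel p p'" "qqz_rel q q'"
  have "snd (p + q) - snd (p' + q') = (snd p - snd p') + (snd q - snd q')" by simp
  then show "qqz_rel (p + q) (p' + q')" using * unfolding qqz_rel_def by (metis Ints_add fst_add)
qed

lift_definition uminus_qqz :: "qqz \<Rightarrow> qqz" is uminus
  unfolding qqz_rel_def by (auto simp: Ints_diff dest: Ints_minus)

definition minus_qqz :: "qqz \<Rightarrow> qqz \<Rightarrow> qqz" where
  "minus_qqz p q = p + - q"

instance
proof
  fix a b c :: qqz
  show "a + b + c = a + (b + c)" by transfer (simp add: qqz_rel_def)
  show "a + b = b + a" by transfer (simp add: qqz_rel_def)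
  show "0 + a = a" by transfer (simp add: qqz_rel_def)
  show "- a + a = 0" by transfer (simp add: qqz_rel_def)
  show "a - b = a + - b" by (rule minus_qqz_def)
qed

end

lemma imul_abs_qqz: "imul k (abs_qqz (a, b)) = abs_qqz (of_int k * a, of_int k * b)"
  using imul_unique[of "\<lambda>k. abs_qqz (of_int k * a, of_int k * b)" "abs_qqz (a, b)" k]
  by (simp add: zero_qqz_def zero_prod_def plus_qqz.abs_eq distrib_right)

lemma abs_qqz_eq_0_iff: "abs_qqz (a, b) = 0 \<longleftrightarrow> a = 0 \<and> b \<in> \<int>"
  by (simp add: zero_qqz_def qqz.abs_eq_iff qqz_rel_def)

lemma qqz_cases: obtains a b where "x = abs_qqz (a, b)"
  by (metis surj_pair Quotient_abs_rep[OF Quotient_qqz])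

lemma qqz_divisible:
  assumes "d \<noteq> 0"
  obtains y :: qqz where "imul d y = x"
proof -
  obtain a b where "x = abs_qqz (a, b)" by (rule qqz_cases)
  then have "imul d (abs_qqz (a / of_int d, b / of_int d)) = x"
    using assms by (simp add: imul_abs_qqz)
  then show ?thesis by (rule that)
qed

text \<open>The case \<open>d = 0\<close> encodes infinite order, as \<open>0 dvd j\<close> only for
  \<open>j = 0\<close>, and is realised in the factor \<rat>. For other \<open>d\<close> the class
  of \<open>1 / d\<close> in \<rat>/\<int> works.\<close>

lemma qqz_element_of_order:
  obtains u :: qqz where "\<And>j. imul j u = 0 \<longleftrightarrow> d dvd j"
proof (cases "d = 0")
  case True
  show ?thesis
    by (rule that[of "abs_qqz (1, 0)"]) (simp add: imul_abs_qqz abs_qqz_eq_0_iff True)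
next
  case False
  show ?thesis
  proof (rule that[of "abs_qqz (0, 1 / of_int d)"])
    fix j
    have "of_int j / of_int d \<in> (\<int> :: rat set) \<longleftrightarrow> d dvd j"
    proof
      assume "of_int j / of_int d \<in> (\<int> :: rat set)"
      then obtain m where "of_int j / of_int d = (of_int m :: rat)" by (elim Ints_cases)
      then have "(of_int j :: rat) = of_int (d * m)" using False by (simp add: field_simps)
      then show "d dvd j" by (metis dvd_triv_left of_int_eq_iff)
    qed (use False in auto)
    then show "imul j (abs_qqz (0, 1 / of_int d)) = 0 \<longleftrightarrow> d dvd j"
      by (simp add: imul_abs_qqz abs_qqz_eq_0_iff)
  qed
qed

lemma countable_qqz: "countable (UNIV :: qqz set)"
proof -
  have "(UNIV :: qqz set) = range abs_qqz" using qqz_cases by (metis UNIV_eq_I rangeI)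
  then show ?thesis by (metis countable_image countableI_type)
qed

section \<open>Embedding abelian groups into direct sums\<close>

text \<open>Graphs of injective partial homomorphisms into finitely supported functions. The last
  condition makes every element outside the domain available as a fresh coordinate.\<close>
definition embedding_graph :: "('g::ab_group_add \<times> ('g \<Rightarrow> qqz)) set \<Rightarrow> bool" where
  "embedding_graph \<Gamma> \<longleftrightarrow> (0, 0) \<in> \<Gamma> \<and> (\<forall>p\<in>\<Gamma>. \<forall>q\<in>\<Gamma>. p - q \<in> \<Gamma>) \<and>
     (\<forall>g f. (g, f) \<in> \<Gamma> \<longrightarrow> (g = 0 \<longleftrightarrow> f = 0) \<and> finite {a. f a \<noteq> 0} \<and> {a. f a \<noteq> 0} \<subseteq> Domain \<Gamma>)"

lemma embedding_graphD:
  assumes "embedding_graph \<Gamma>"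
  shows "(0, 0) \<in> \<Gamma>" "\<And>p q. p \<in> \<Gamma> \<Longrightarrow> q \<in> \<Gamma> \<Longrightarrow> p - q \<in> \<Gamma>"
    "\<And>g f. (g, f) \<in> \<Gamma> \<Longrightarrow> g = 0 \<longleftrightarrow> f = 0" "\<And>g f. (g, f) \<in> \<Gamma> \<Longrightarrow> finite {a. f a \<noteq> 0}"
    "\<And>g f a. (g, f) \<in> \<Gamma> \<Longrightarrow> f a \<noteq> 0 \<Longrightarrow> a \<in> Domain \<Gamma>"
  using assms unfolding embedding_graph_def by (simp, simp, metis, metis, blast)

lemma embedding_graph_add:
  assumes "embedding_graph \<Gamma>" "p \<in> \<Gamma>" "q \<in> \<Gamma>"
  shows "p + q \<in> \<Gamma>"
proof -
  have "0 - q \<in> \<Gamma>"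
    using embedding_graphD(1,2)[OF assms(1)] assms(3) by (metis zero_prod_def)
  then have "p - (0 - q) \<in> \<Gamma>" by (rule embedding_graphD(2)[OF assms(1,2)])
  then show ?thesis by simp
qed

lemma embedding_graph_imul:
  assumes \<Gamma>: "embedding_graph \<Gamma>" and p: "p \<in> \<Gamma>"
  shows "imul k p \<in> \<Gamma>"
proof (induction k rule: int_induct[where k = 0])
  case base
  then show ?case using embedding_graphD(1)[OF \<Gamma>] by (simp add: zero_prod_def)
qed (auto simp: imul_Suc imul_pred embedding_graph_add[OF \<Gamma>] embedding_graphD(2)[OF \<Gamma>] p)

lemma embedding_graph_Union:
  assumes "subset.chain {\<Gamma>. embedding_graph \<Gamma>} \<C>" "\<C> \<noteq> {}"
  shows "embedding_graph (\<Union>\<C>)"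
proof -
  have \<C>: "\<And>\<Gamma>. \<Gamma> \<in> \<C> \<Longrightarrow> embedding_graph \<Gamma>"
    and chain: "\<And>\<Gamma> \<Delta>. \<Gamma> \<in> \<C> \<Longrightarrow> \<Delta> \<in> \<C> \<Longrightarrow> \<Gamma> \<subseteq> \<Delta> \<or> \<Delta> \<subseteq> \<Gamma>"
    using assms(1) by (auto simp: subset_chain_def)
  have "p - q \<in> \<Union>\<C>" if pq: "p \<in> \<Union>\<C>" "q \<in> \<Union>\<C>" for p q
  proof -
    obtain \<Gamma> where "\<Gamma> \<in> \<C>" "p \<in> \<Gamma>" "q \<in> \<Gamma>" using pq chain by blast
    then show ?thesis using embedding_graphD(2)[OF \<C>] by blast
  qed
  moreover have "(0, 0) \<in> \<Union>\<C>" using assms(2) embedding_graphD(1)[OF \<C>] by blast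
  moreover have "(g = 0 \<longleftrightarrow> f = 0) \<and> finite {a. f a \<noteq> 0} \<and> {a. f a \<noteq> 0} \<subseteq> Domain (\<Union>\<C>)"
    if gf: "(g, f) \<in> \<Union>\<C>" for g f
  proof -
    obtain \<Gamma> where \<Gamma>: "\<Gamma> \<in> \<C>" "(g, f) \<in> \<Gamma>" using gf by blast
    show ?thesis
      using embedding_graphD(3,4)[OF \<C>[OF \<Gamma>(1)] \<Gamma>(2)] embedding_graphD(5)[OF \<C>[OF \<Gamma>(1)] \<Gamma>(2)] \<Gamma>(1)
      by blast
  qed
  ultimately show ?thesis unfolding embedding_graph_def by (intro conjI ballI allI impI) metis+
qed

text \<open>The multiples of \<open>g\<close> already in the domain are those by multiples of some
  \<open>d\<close>. So \<open>g\<close> must go to some \<open>c'\<close> with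
  \<open>imul d c' = \<psi>\<close>, where \<psi> is the value at \<open>imul d g\<close>;
  divisibility provides one coordinate by coordinate.\<close>

lemma embedding_graph_extend:
  fixes g :: "'g::ab_group_add"
  assumes \<Gamma>: "embedding_graph \<Gamma>" and g: "g \<notin> Domain \<Gamma>"
  obtains \<Delta> where "embedding_graph \<Delta>" "\<Gamma> \<subset> \<Delta>"
proof -
  note D = embedding_graphD[OF \<Gamma>]
  obtain d where d: "\<And>k. k \<in> {k. imul k g \<in> Domain \<Gamma>} \<longleftrightarrow> d dvd k"
  proof (rule int_ideal_principal)
    show "0 \<in> {k. imul k g \<in> Domain \<Gamma>}" using D(1) by auto
    show "a - b \<in> {k. imul k g \<in> Domain \<Gamma>}"
      if ab: "a \<in> {k. imul k g \<in> Domain \<Gamma>}" "b \<in> {k. imul k g \<in> Domain \<Gamma>}" for a b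
    proof -
      obtain e f where "(imul a g, e) \<in> \<Gamma>" "(imul b g, f) \<in> \<Gamma>" using ab by blast
      then show ?thesis using D(2)[of "(imul a g, e)" "(imul b g, f)"] by (auto simp: imul_diff)
    qed
    show "a * b \<in> {k. imul k g \<in> Domain \<Gamma>}" if b: "b \<in> {k. imul k g \<in> Domain \<Gamma>}" for a b
    proof -
      obtain f where "(imul b g, f) \<in> \<Gamma>" using b by blast
      then show ?thesis
        using embedding_graph_imul[OF \<Gamma>, of "(imul b g, f)" a] by (auto simp: imul_imul imul_Pair)
    qed
  qed blast
  obtain \<psi> where \<psi>: "(imul d g, \<psi>) \<in> \<Gamma>" using d[of d] by auto
  \<comment> \<open>Choosing 0 wherever \<psi> vanishes keeps the support finite. If
    \<open>d = 0\<close>, then \<psi> is the value at 0, hence zero.\<close>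
  have "\<exists>y. imul d y = \<psi> a \<and> (\<psi> a = 0 \<longrightarrow> y = 0)" for a
  proof (cases "d = 0 \<or> \<psi> a = 0")
    case True
    then have "\<psi> a = 0" using D(3)[OF \<psi>] by auto
    then show ?thesis by auto
  next
    case False
    then show ?thesis by (metis qqz_divisible)
  qed
  then obtain c where c: "\<And>a. imul d (c a) = \<psi> a" "\<And>a. \<psi> a = 0 \<Longrightarrow> c a = 0" by metis
  obtain u :: qqz where u: "\<And>j. imul j u = 0 \<longleftrightarrow> d dvd j" by (rule qqz_element_of_order[of d]) blast
  \<comment> \<open>The coordinate \<open>g\<close> is fresh: functions occurring in \<Gamma> vanish
    there because \<open>g\<close> is outside the domain. As \<open>imul d u = 0\<close>, the new
    value does not disturb \<open>imul d c' = \<psi>\<close>, and its order being exactly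
    \<open>d\<close> gives injectivity.\<close>
  define c' where "c' = c(g := u)"
  have \<psi>g: "\<psi> g = 0" using D(5)[OF \<psi>] g by blast
  have c'_multiple: "imul (m * d) c' = imul m \<psi>" for m
  proof
    fix a
    show "imul (m * d) c' a = imul m \<psi> a"
      using u[of "m * d"] \<psi>g by (cases "a = g") (auto simp: c'_def imul_fun c(1) simp flip: imul_imul)
  qed
  define \<Delta> where "\<Delta> = {(h + imul j g, f + imul j c') | h f j. (h, f) \<in> \<Gamma>}"
  have \<Delta>I: "(h + imul j g, f + imul j c') \<in> \<Delta>" if "(h, f) \<in> \<Gamma>" for h f j
    using that unfolding \<Delta>_def by blast
  have sub: "\<Gamma> \<subseteq> \<Delta>" using \<Delta>I[where j = 0] by auto
  have g\<Delta>: "g \<in> Domain \<Delta>" using \<Delta>I[OF D(1), of 1] by auto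
  have in_\<Gamma>: "(h + imul j g, f + imul j c') \<in> \<Gamma>" if hf: "(h, f) \<in> \<Gamma>" "d dvd j" for h f j
  proof -
    obtain m where "j = m * d" using hf(2) by (metis dvd_def mult.commute)
    then have "(imul j g, imul j c') = imul m (imul d g, \<psi>)"
      by (simp add: imul_Pair imul_imul c'_multiple)
    then have "(imul j g, imul j c') \<in> \<Gamma>" using embedding_graph_imul[OF \<Gamma> \<psi>] by simp
    then show ?thesis using embedding_graph_add[OF \<Gamma> hf(1)] by fastforce
  qed
  have "embedding_graph \<Delta>"
    unfolding embedding_graph_def
  proof (intro conjI ballI allI impI)
    show "(0, 0) \<in> \<Delta>" using sub D(1) by blast
  next
    fix p q assume "p \<in> \<Delta>" "q \<in> \<Delta>"
    then obtain h f j h' f' j' where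
      p: "(h, f) \<in> \<Gamma>" "p = (h + imul j g, f + imul j c')" and
      q: "(h', f') \<in> \<Gamma>" "q = (h' + imul j' g, f' + imul j' c')"
      unfolding \<Delta>_def by blast
    have "(h - h', f - f') \<in> \<Gamma>" using D(2)[OF p(1) q(1)] by simp
    from \<Delta>I[OF this, of "j - j'"] show "p - q \<in> \<Delta>"
      by (simp add: p q imul_diff algebra_simps)
  next
    fix x e assume "(x, e) \<in> \<Delta>"
    then obtain h f j where p: "(h, f) \<in> \<Gamma>" "x = h + imul j g" "e = f + imul j c'"
      unfolding \<Delta>_def by blast
    \<comment> \<open>If either component vanishes, then \<open>d dvd j\<close>. The pair then lies
      in \<Gamma>, where the components vanish together.\<close>
    have "d dvd j" if "h + imul j g = 0"
    proof -
      have "imul j g = 0 - h" using that by (simp add: eq_neg_iff_add_eq_0 add.commute)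
      then have "imul j g \<in> Domain \<Gamma>" using D(2)[OF D(1) p(1)] by auto
      then show ?thesis using d by simp
    qed
    moreover have "d dvd j" if "f + imul j c' = 0"
    proof -
      have "f g = 0" using D(5)[OF p(1)] g by blast
      then have "imul j u = 0"
        using fun_cong[OF that, of g] by (simp add: imul_fun c'_def)
      then show ?thesis using u by simp
    qed
    ultimately have iff: "h + imul j g = 0 \<longleftrightarrow> f + imul j c' = 0"
      using D(3)[OF in_\<Gamma>[OF p(1)]] by blast
    have supp: "{a. (f + imul j c') a \<noteq> 0} \<subseteq> {a. f a \<noteq> 0} \<union> {a. \<psi> a \<noteq> 0} \<union> {g}"
      by (auto simp: imul_fun c'_def c(2))
    \<comment> \<open>The only coordinate newly used is \<open>g\<close>, which joins the domain at
      the same time, so points outside the domain remain fresh.\<close>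
    have "{a. f a \<noteq> 0} \<union> {a. \<psi> a \<noteq> 0} \<union> {g} \<subseteq> Domain \<Delta>"
      using D(5)[OF p(1)] D(5)[OF \<psi>] sub g\<Delta> by blast
    then show "{a. e a \<noteq> 0} \<subseteq> Domain \<Delta>" unfolding p(3) by (rule order_trans[OF supp])
    show "finite {a. e a \<noteq> 0}"
      unfolding p(3) using D(4)[OF p(1)] D(4)[OF \<psi>] by (intro finite_subset[OF supp]) simp
    show "x = 0 \<longleftrightarrow> e = 0" using iff p by simp
  qed
  moreover have "\<Gamma> \<subset> \<Delta>" using g g\<Delta> by (intro psubsetI[OF sub]) auto
  ultimately show ?thesis by (rule that)
qed

text \<open>By Zorn's lemma there is a maximal graph, and the extension step makes its domain
  everything. Closure under differences, with only (0, 0) having a zero component, makes it the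
  graph of an injective homomorphism.\<close>

theorem ab_group_embedding:
  obtains \<phi> :: "'g::ab_group_add \<Rightarrow> 'g \<Rightarrow> qqz"
  where "\<And>x y. \<phi> (x + y) = \<phi> x + \<phi> y" "inj \<phi>" "\<And>x. finite {a. \<phi> x a \<noteq> 0}"
proof -
  have "embedding_graph {(0 :: 'g, 0)}"
    unfolding embedding_graph_def by (auto simp: zero_prod_def)
  then have "\<exists>\<Gamma> \<in> {\<Gamma> :: ('g \<times> ('g \<Rightarrow> qqz)) set. embedding_graph \<Gamma>}.
      \<forall>\<Delta> \<in> {\<Gamma>. embedding_graph \<Gamma>}. \<Gamma> \<subseteq> \<Delta> \<longrightarrow> \<Delta> = \<Gamma>"
    by (intro subset_Zorn_nonempty) (auto intro: embedding_graph_Union)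
  then obtain \<Gamma> :: "('g \<times> ('g \<Rightarrow> qqz)) set" where \<Gamma>: "embedding_graph \<Gamma>"
    and max: "\<And>\<Delta>. embedding_graph \<Delta> \<Longrightarrow> \<Gamma> \<subseteq> \<Delta> \<Longrightarrow> \<Delta> = \<Gamma>" by blast
  note D = embedding_graphD[OF \<Gamma>]
  have "x \<in> Domain \<Gamma>" for x
    using embedding_graph_extend[OF \<Gamma>, of x] max by (metis psubset_eq)
  then obtain \<phi> where \<phi>: "\<And>x. (x, \<phi> x) \<in> \<Gamma>" unfolding Domain_iff by metis
  show ?thesis
  proof (rule that)
    fix x y
    have "(x + y, \<phi> x + \<phi> y) \<in> \<Gamma>" using embedding_graph_add[OF \<Gamma> \<phi>[of x] \<phi>[of y]] by simp
    from D(2)[OF \<phi> this] show "\<phi> (x + y) = \<phi> x + \<phi> y" using D(3) by fastforce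
  next
    show "inj \<phi>"
    proof (rule injI)
      fix x y assume "\<phi> x = \<phi> y"
      then have "(x - y, 0) \<in> \<Gamma>" using D(2)[OF \<phi>[of x] \<phi>[of y]] by simp
      then show "x = y" using D(3) by fastforce
    qed
  qed (rule D(4)[OF \<phi>])
qed

section \<open>The group of fractions\<close>

text \<open>A pair stands for the formal difference of its components; the equation is cross-added
  to avoid subtraction.\<close>

definition gfrac_rel :: "'a::{ab_semigroup_add, cancel_semigroup_add} \<times> 'a \<Rightarrow> 'a \<times> 'a \<Rightarrow> bool" where
  "gfrac_rel p q \<longleftrightarrow> fst p + snd q = fst q + snd p"

text \<open>Cancellativity enters here: the middle term \<open>snd q\<close> is added to both sides
  and then cancelled.\<close>

lemma gfrac_rel_trans:
  assumes "gfrac_rel p q" "gfrac_rel q r"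
  shows "gfrac_rel p r"
proof -
  have "(fst p + snd r) + snd q = (fst p + snd q) + snd r" by (simp add: ac_simps)
  also have "\<dots> = (fst q + snd r) + snd p" using assms(1) by (simp add: gfrac_rel_def ac_simps)
  also have "\<dots> = (fst r + snd p) + snd q" using assms(2) by (simp add: gfrac_rel_def ac_simps)
  finally show ?thesis by (simp add: gfrac_rel_def)
qed

quotient_type (overloaded) 'a gfrac =
  "'a::{ab_semigroup_add, cancel_semigroup_add} \<times> 'a" / gfrac_rel
proof (rule equivpI)
  show "reflp gfrac_rel" by (simp add: reflp_def gfrac_rel_def)
  show "symp gfrac_rel" by (simp add: symp_def gfrac_rel_def)
  show "transp gfrac_rel" using gfrac_rel_trans by (auto simp: transp_def)
qed

instantiation gfrac :: ("{ab_semigroup_add, cancel_semigroup_add}") ab_group_add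
begin

text \<open>Every pair with equal components represents zero. The semigroup may have no neutral
  element, so an arbitrary element is used.\<close>

lift_definition zero_gfrac :: "'a gfrac" is "(undefined, undefined)" .

lift_definition plus_gfrac :: "'a gfrac \<Rightarrow> 'a gfrac \<Rightarrow> 'a gfrac"
  is "\<lambda>p q. (fst p + fst q, snd p + snd q)"
proof -
  fix p p' q q' :: "'a \<times> 'a"
  assume *: "gfrac_rel p p'" "gfrac_rel q q'"
  have "(fst p + fst q) + (snd p' + snd q') = (fst p + snd p') + (fst q + snd q')"
    by (simp add: ac_simps)
  also have "\<dots> = (fst p' + snd p) + (fst q' + snd q)" using * by (simp add: gfrac_rel_def)
  also have "\<dots> = (fst p' + fst q') + (snd p + snd q)" by (simp add: ac_simps)
  finally show "gfrac_rel (fst p + fst q, snd p + snd q) (fst p' + fst q', snd p' + snd q')"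
    by (simp add: gfrac_rel_def)
qed

lift_definition uminus_gfrac :: "'a gfrac \<Rightarrow> 'a gfrac" is "\<lambda>p. (snd p, fst p)"
  by (simp add: gfrac_rel_def add.commute)

definition minus_gfrac :: "'a gfrac \<Rightarrow> 'a gfrac \<Rightarrow> 'a gfrac" where
  "minus_gfrac p q = p + - q"

instance
proof
  fix a b c :: "'a gfrac"
  show "a + b + c = a + (b + c)" by transfer (simp add: gfrac_rel_def ac_simps)
  show "a + b = b + a" by transfer (simp add: gfrac_rel_def ac_simps)
  show "0 + a = a" by transfer (simp add: gfrac_rel_def ac_simps)
  show "- a + a = 0" by transfer (simp add: gfrac_rel_def ac_simps)
  show "a - b = a + - b" by (rule minus_gfrac_def)
qed

end

text \<open>With no zero to subtract, \<open>x\<close> is written as the difference of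
  \<open>x + x\<close> and \<open>x\<close>.\<close>

lift_definition of_semigroup :: "'a::{ab_semigroup_add, cancel_semigroup_add} \<Rightarrow> 'a gfrac"
  is "\<lambda>x. (x + x, x)" .

lemma of_semigroup_add: "of_semigroup (x + y) = of_semigroup x + of_semigroup y"
  by transfer (simp add: gfrac_rel_def ac_simps)

lemma inj_of_semigroup: "inj of_semigroup"
proof (rule injI)
  fix x y :: 'a
  assume "of_semigroup x = of_semigroup y"
  then have "x + x + y = y + y + x" by transfer (simp add: gfrac_rel_def)
  then have "x + (x + y) = y + (x + y)" by (simp add: ac_simps)
  then show "x = y" by simp
qed

corollary semigroup_embedding:
  obtains \<theta> :: "'a::{ab_semigroup_add, cancel_semigroup_add} \<Rightarrow> 'a gfrac \<Rightarrow> qqz"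
  where "\<And>x y. \<theta> (x + y) = \<theta> x + \<theta> y" "inj \<theta>" "\<And>x. finite {a. \<theta> x a \<noteq> 0}"
proof -
  obtain \<phi> :: "'a gfrac \<Rightarrow> 'a gfrac \<Rightarrow> qqz"
    where \<phi>: "\<And>x y. \<phi> (x + y) = \<phi> x + \<phi> y" "inj \<phi>" "\<And>x. finite {a. \<phi> x a \<noteq> 0}"
    by (rule ab_group_embedding) blast
  show ?thesis
    by (rule that[of "\<phi> \<circ> of_semigroup"])
      (simp_all add: \<phi> of_semigroup_add inj_compose inj_of_semigroup)
qed

section \<open>Supports of finite sums\<close>

lemma countable_functions_with_support:
  assumes "finite r" "countable (UNIV :: 'c set)"
  shows "countable {f :: 'i \<Rightarrow> 'c::zero. {a. f a \<noteq> 0} = r}"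
proof -
  \<comment> \<open>Relaxing equality to inclusion makes the induction work: a function supported in
    \<open>insert b r\<close> is one supported in \<open>r\<close> with its value at
    \<open>b\<close> overwritten.\<close>
  have "countable {f :: 'i \<Rightarrow> 'c. {a. f a \<noteq> 0} \<subseteq> r}" using assms(1)
  proof (induction r)
    case empty
    have "{f :: 'i \<Rightarrow> 'c. {a. f a \<noteq> 0} \<subseteq> {}} = {\<lambda>_. 0}" by auto
    then show ?case by simp
  next
    case (insert b r)
    have "f \<in> (\<lambda>(h, c). h(b := c)) ` ({f. {a. f a \<noteq> 0} \<subseteq> r} \<times> UNIV)"
      if "{a. f a \<noteq> 0} \<subseteq> insert b r" for f :: "'i \<Rightarrow> 'c"
      using that by (intro image_eqI[of _ _ "(f(b := 0), f b)"]) auto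
    then have "{f :: 'i \<Rightarrow> 'c. {a. f a \<noteq> 0} \<subseteq> insert b r}
        \<subseteq> (\<lambda>(h, c). h(b := c)) ` ({f. {a. f a \<noteq> 0} \<subseteq> r} \<times> UNIV)" by blast
    moreover have "countable ({f :: 'i \<Rightarrow> 'c. {a. f a \<noteq> 0} \<subseteq> r} \<times> (UNIV :: 'c set))"
      using insert.IH assms(2) by (rule countable_SIGMA)
    ultimately show ?case by (meson countable_image countable_subset)
  qed
  then show ?thesis by (rule countable_subset[rotated]) auto
qed

lemma uncountable_same_card:
  fixes S :: "'x \<Rightarrow> 'i set"
  assumes "uncountable X"
  obtains k where "uncountable {x \<in> X. card (S x) = k}"
proof -
  have "\<not> (\<forall>k. countable {x \<in> X. card (S x) = k})"
  proof
    assume "\<forall>k. countable {x \<in> X. card (S x) = k}"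
    then have "countable (\<Union>k. {x \<in> X. card (S x) = k})" by (intro countable_UN) auto
    moreover have "(\<Union>k. {x \<in> X. card (S x) = k}) = X" by auto
    ultimately show False using assms by simp
  qed
  then show ?thesis using that by blast
qed

text \<open>A substitute for the delta-system lemma: take \<open>r\<close> maximal with uncountably many
  \<open>x\<close> satisfying \<open>r \<subseteq> S x\<close>; then any given point outside \<open>r\<close> is in only countably many of them.\<close>
lemma uncountable_weak_delta_system:
  fixes S :: "'x \<Rightarrow> 'i set"
  assumes X: "uncountable X" and fin: "\<And>x. finite (S x)"
    and fib: "\<And>r. finite r \<Longrightarrow> countable {x \<in> X. S x = r}"
  obtains Y r m where "Y \<subseteq> X" "uncountable Y" "finite r" "m > 0"
    "\<And>x. x \<in> Y \<Longrightarrow> card (S x - r) = m" "\<And>a. a \<notin> r \<Longrightarrow> countable {x \<in> Y. a \<in> S x}"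
proof -
  obtain k where k: "uncountable {x \<in> X. card (S x) = k}" using uncountable_same_card[OF X] .
  define Y where "Y r = {x \<in> X. card (S x) = k \<and> r \<subseteq> S x}" for r
  define P where "P r \<longleftrightarrow> finite r \<and> uncountable (Y r)" for r
  have bound: "card r \<le> k" if "P r" for r
  proof -
    have "Y r \<noteq> {}" using that unfolding P_def by auto
    then obtain x where "card (S x) = k" "r \<subseteq> S x" unfolding Y_def by blast
    then show ?thesis using card_mono[OF fin] by metis
  qed
  have "P {}" using k by (simp add: P_def Y_def)
  \<comment> \<open>A set of largest size exists because all candidates have at most
    \<open>k\<close> elements.\<close>
  then obtain r where r: "P r" and max: "\<And>r'. P r' \<Longrightarrow> card r' \<le> card r"
    using Lattices_Big.ex_has_greatest_nat[of P "{}" card "Suc k"] bound by (auto simp: less_Suc_eq_le)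
  \<comment> \<open>Otherwise every \<open>x\<close> in \<open>Y r\<close> would have
    \<open>S x = r\<close>, against the countability of the fibres. This yields
    \<open>m > 0\<close>.\<close>
  have "card r \<noteq> k"
  proof
    assume eq: "card r = k"
    have "Y r \<subseteq> {x \<in> X. S x = r}"
      using eq fin by (auto simp: Y_def dest: card_subset_eq[OF fin])
    then show False using fib r unfolding P_def by (meson countable_subset)
  qed
  show ?thesis
  proof (rule that)
    show "Y r \<subseteq> X" by (auto simp: Y_def)
    show "uncountable (Y r)" "finite r" using r by (auto simp: P_def)
    show "k - card r > 0" using bound[OF r] \<open>card r \<noteq> k\<close> by simp
    show "card (S x - r) = k - card r" if "x \<in> Y r" for x
      using that r by (auto simp: Y_def P_def card_Diff_subset)
    show "countable {x \<in> Y r. a \<in> S x}" if "a \<notin> r" for a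
    proof -
      have "{x \<in> Y r. a \<in> S x} = Y (insert a r)" by (auto simp: Y_def)
      moreover have "\<not> P (insert a r)" using max[of "insert a r"] that r by (auto simp: P_def)
      ultimately show ?thesis using r by (simp add: P_def)
    qed
  qed
qed

text \<open>Summands are chosen one by one with supports disjoint outside a fixed finite
  \<open>r\<close>, so each contributes exactly \<open>m\<close> coordinates there. Cancellation
  inside \<open>r\<close> is not controlled, but costs at most \<open>b = card r\<close>.\<close>

lemma FS_support_card:
  fixes \<theta> :: "'a::ab_semigroup_add \<Rightarrow> 'i \<Rightarrow> 'c::ab_group_add"
  defines "S \<equiv> \<lambda>x. {a. \<theta> x a \<noteq> 0}"
  assumes add: "\<And>x y. \<theta> (x + y) = \<theta> x + \<theta> y" and inj: "inj \<theta>" and fin: "\<And>x. finite (S x)"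
    and C: "countable (UNIV :: 'c set)" and X: "uncountable X"
  obtains m b where "m > 0" "\<And>n. n > 0 \<Longrightarrow> \<exists>s\<in>FS X. n * m \<le> card (S s) \<and> card (S s) \<le> n * m + b"
proof -
  have fib: "countable {x \<in> X. S x = r}" if "finite r" for r
  proof -
    have "countable {x \<in> X. \<theta> x \<in> {f. {a. f a \<noteq> 0} = r}}"
      using inj_on_subset[OF inj subset_UNIV] countable_functions_with_support[OF that C]
      by (rule countable_image_inj_gen)
    then show ?thesis by (simp add: S_def)
  qed
  obtain Y r m where Y: "Y \<subseteq> X" "uncountable Y" and r: "finite r" and m: "m > 0"
    and tail: "\<And>x. x \<in> Y \<Longrightarrow> card (S x - r) = m" "\<And>a. a \<notin> r \<Longrightarrow> countable {x \<in> Y. a \<in> S x}"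
    using uncountable_weak_delta_system[OF X fin fib] by metis
  have sums: "\<exists>F s. F \<subseteq> Y \<and> finite F \<and> F \<noteq> {} \<and> fsum F s \<and> card (S s - r) = Suc n * m" for n
  proof (induction n)
    case 0
    obtain x where "x \<in> Y" using Y(2) by (metis countable_empty equals0I)
    then have "{x} \<subseteq> Y \<and> finite {x} \<and> {x} \<noteq> {} \<and> fsum {x} x \<and> card (S x - r) = Suc 0 * m"
      using tail(1) fsum.single by auto
    then show ?case by blast
  next
    case (Suc n)
    then obtain F s where F: "F \<subseteq> Y" "finite F" "fsum F s" "card (S s - r) = Suc n * m" by blast
    \<comment> \<open>The next summand must be new and must avoid the support of \<open>s\<close>
      outside \<open>r\<close>; this excludes only countably many elements of
      \<open>Y\<close>.\<close>
    have "countable (F \<union> (\<Union>a \<in> S s - r. {x \<in> Y. a \<in> S x}))"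
      using F(2) fin tail(2) by (intro countable_Un countable_UN) (auto simp: countable_finite)
    then have "\<not> Y \<subseteq> F \<union> (\<Union>a \<in> S s - r. {x \<in> Y. a \<in> S x})"
      using Y(2) countable_subset by metis
    then obtain x where x: "x \<in> Y" "x \<notin> F" "\<And>a. a \<in> S s - r \<Longrightarrow> a \<notin> S x"
      by auto
    \<comment> \<open>Outside \<open>r\<close> at most one of the two values is nonzero, so nothing
      cancels.\<close>
    have "a \<in> S (x + s) \<longleftrightarrow> a \<in> S x \<or> a \<in> S s" if "a \<notin> r" for a
      using x(3)[of a] that by (cases "a \<in> S s") (auto simp: S_def add)
    then have "S (x + s) - r = (S x - r) \<union> (S s - r)" by auto
    moreover have "(S x - r) \<inter> (S s - r) = {}" using x(3) by blast
    ultimately have "card (S (x + s) - r) = Suc (Suc n) * m"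
      using F(4) tail(1)[OF x(1)] fin by (simp add: card_Un_disjoint)
    moreover have "fsum (insert x F) (x + s)" using F(3) x(2) by (rule fsum.insert)
    ultimately show ?case using F x(1) by (intro exI[of _ "insert x F"] exI[of _ "x + s"]) auto
  qed
  show ?thesis
  proof (rule that[OF m, of "card r"])
    fix n :: nat assume "n > 0"
    then obtain F s where s: "F \<subseteq> Y" "finite F" "F \<noteq> {}" "fsum F s" "card (S s - r) = n * m"
      using sums[of "n - 1"] by auto
    have "card (S s) = card (S s - r) + card (S s \<inter> r)"
      using card_Int_Diff[OF fin, of s r] by simp
    moreover have "card (S s \<inter> r) \<le> card r" using r by (simp add: card_mono)
    moreover have "s \<in> FS X" using s Y(1) unfolding FS_def by blast
    ultimately show "\<exists>s\<in>FS X. n * m \<le> card (S s) \<and> card (S s) \<le> n * m + card r"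
      using s(5) by (intro bexI[of _ s]) auto
  qed
qed

section \<open>Dyadic intervals and the colouring\<close>

text \<open>Take \<open>n\<close> to be \<open>2 ^ k / m\<close> rounded up: \<open>n * m\<close>
  exceeds \<open>2 ^ k\<close> by less than \<open>m\<close>, and \<open>m + b \<le> 2 ^ k\<close>
  leaves room for the error \<open>b\<close>.\<close>

lemma multiple_in_dyadic_interval:
  fixes m b k :: nat
  assumes "m > 0" "m + b \<le> 2 ^ k"
  obtains n where "n > 0" "2 ^ k \<le> n * m" "n * m + b < 2 ^ Suc k"
proof (rule that[of "(2 ^ k + m - 1) div m"])
  let ?n = "(2 ^ k + m - 1) div m"
  have eq: "?n * m + (2 ^ k + m - 1) mod m = 2 ^ k + m - 1" by simp
  moreover have "(2 ^ k + m - 1) mod m < m" using assms(1) by simp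
  ultimately show le: "2 ^ k \<le> ?n * m" by linarith
  then show "?n > 0" by (metis gr0I mult_0 not_le zero_less_numeral zero_less_power)
  have "?n * m < 2 ^ k + m" using eq assms(1) by linarith
  then show "?n * m + b < 2 ^ Suc k" using assms(2) by simp
qed

theorem theorem3p2:
  fixes G :: "'a::{ab_semigroup_add, cancel_semigroup_add} itself"
  shows "(\<exists>A0 A1 :: 'a set. A0 \<union> A1 = UNIV \<and> A0 \<inter> A1 = {} \<and>
            \<not> (\<exists>X. uncountable X \<and> (FS X \<subseteq> A0 \<or> FS X \<subseteq> A1)))
         \<and> (\<forall>L :: 'b set. uncountable L \<longrightarrow> \<not> Hind G L)"
proof -
  obtain \<theta> :: "'a \<Rightarrow> 'a gfrac \<Rightarrow> qqz"
    where \<theta>: "\<And>x y. \<theta> (x + y) = \<theta> x + \<theta> y" "inj \<theta>" "\<And>x. finite {a. \<theta> x a \<noteq> 0}"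
    by (rule semigroup_embedding) blast
  define N where "N x = card {a. \<theta> x a \<noteq> 0}" for x
  \<comment> \<open>Only sizes in dyadic intervals of even index count, so an empty support falls
    into the complement.\<close>
  define A where "A = {x. \<exists>k. even k \<and> 2 ^ k \<le> N x \<and> N x < 2 ^ Suc k}"
  have no_FS: "\<not> FS X \<subseteq> A \<and> \<not> FS X \<subseteq> - A" if X: "uncountable X" for X
  proof -
    obtain m b where m: "m > 0"
      and mb: "\<And>n. n > 0 \<Longrightarrow> \<exists>s\<in>FS X. n * m \<le> N s \<and> N s \<le> n * m + b"
      using FS_support_card[OF \<theta> countable_qqz X] unfolding N_def by blast
    have ex: "\<exists>s\<in>FS X. 2 ^ k \<le> N s \<and> N s < 2 ^ Suc k" if "k \<ge> m + b" for k
    proof -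
      have "m + b \<le> 2 ^ k" using that less_exp[of k] by linarith
      then obtain n where n: "n > 0" "2 ^ k \<le> n * m" "n * m + b < 2 ^ Suc k"
        using multiple_in_dyadic_interval m by blast
      then show ?thesis using mb[OF n(1)] by (meson le_less_trans le_trans)
    qed
    \<comment> \<open>An even index large enough for \<open>ex\<close>; the odd index
      \<open>Suc l\<close> then gives a sum of the other colour.\<close>
    define l where "l = 2 * (m + b)"
    obtain s where s: "s \<in> FS X" "2 ^ l \<le> N s" "N s < 2 ^ Suc l"
      using ex[of l] by (auto simp: l_def)
    then have "s \<in> A" unfolding A_def l_def by (intro CollectI exI[of _ "2 * (m + b)"]) simp
    moreover obtain t where t: "t \<in> FS X" "2 ^ Suc l \<le> N t" "N t < 2 ^ Suc (Suc l)"
      using ex[of "Suc l"] by (auto simp: l_def)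
    moreover have "t \<notin> A"
    proof
      assume "t \<in> A"
      then obtain k where k: "even k" "2 ^ k \<le> N t" "N t < 2 ^ Suc k" unfolding A_def by blast
      \<comment> \<open>Dyadic intervals are disjoint, so the index \<open>k\<close> is forced to be
        the odd number \<open>Suc l\<close>.\<close>
      have "(2::nat) ^ k < 2 ^ Suc (Suc l)" "(2::nat) ^ Suc l < 2 ^ Suc k"
        using k t by linarith+
      then have "k < Suc (Suc l)" "Suc l < Suc k"
        using power_strict_increasing_iff[of "2::nat"] by (metis one_less_numeral_iff semiring_norm(76))+
      then have "k = Suc l" by simp
      then show False using k(1) by (simp add: l_def)
    qed
    ultimately show ?thesis using s(1) by blast
  qed
  have "\<not> Hind G L" if "uncountable L" for L :: "'b set"
  proof
    assume "Hind G L"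
    then obtain X where X: "X \<approx> L" "FS X \<subseteq> A \<or> FS X \<subseteq> - A"
      unfolding Hind_def by (metis Compl_disjoint Compl_partition)
    have "uncountable X" using that countable_eqpoll eqpoll_sym[OF X(1)] by metis
    from no_FS[OF this] show False using X(2) by simp
  qed
  moreover have "A \<union> - A = UNIV \<and> A \<inter> - A = {} \<and>
      \<not> (\<exists>X. uncountable X \<and> (FS X \<subseteq> A \<or> FS X \<subseteq> - A))"
    using no_FS by (metis Compl_disjoint Compl_partition)
  ultimately show ?thesis by metis
qed

end
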